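(* Let $\epsilon>0$ and let $\Delta\mathbf H>0$ be the $L_1$-global sensitivity of the Euler histogram construction $D\mapsto \mathbf H(D)$. Then the randomised mechanism DiffPriv, which maps a database $D$ of planar bodies to the vector $\mathbf H'$ with $H'_i=\max\left(0,\,H_i(D)+Y_i\right)$, $i\in\mathcal F\cup\mathcal E\cup\mathcal V$, where the $Y_i$ are i.i.d. Laplace random variables with mean $0$ and scale $\Delta\mathbf H/\epsilon$, preserves $\epsilon$-differential privacy.
   Context: Setting: a bounded region of $\mathbb R^2$ is partitioned into finitely many convex cells, with faces, edges (face intersections) and vertices (edge intersections) indexed by finite disjoint sets $\mathcal F,\mathcal E,\mathcal V$; $P_i\subset\mathbb R^2$ denotes the face, edge or vertex with index $i$. A database $D$ is a finite collection of records, each record being a convex planar body of Euclidean diameter at most a fixed $B>0$. The Euler histogram construction maps $D$ to the vector $\mathbf H(D)$ with $H_i(D)$ equal to the number of records $x$ of $D$ with $x\cap P_i\ne\emptyset$. Two databases are neighbours if they have equal size and differ in exactly one record. The $L_1$-global sensitivity of a deterministic real-vector-valued function $f$ of a database is $\Delta f=\max_{D,D'}\|f(D)-f(D')\|_1$ over all pairs of neighbouring databases. A randomised mechanism $\mathcal M$ preserves $\epsilon$-differential privacy if for all neighbouring $D,D'$ and all measurable $C$ in the response set, $\Pr(\mathcal M(D)\in C)\le e^{\epsilon}\Pr(\mathcal M(D')\in C)$. The Laplace distribution with mean $0$ and scale $\lambda$ has density $\frac{1}{2\lambda}e^{-|y|/\lambda}$. *)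

theory Defs
  imports "HOL-Probability.Probability"
begin

type_synonym database = "(real ^ 2) set multiset"

text \<open>
  The cells are closed and may overlap only in their boundaries, so that edges and vertices are
  literally intersections of faces and edges. Two faces sharing a single point do not form an
  edge. Edges and vertices are indexed without repetition: a point where several edges meet is
  one vertex.
\<close>

definition cell_partition ::
  "(real ^ 2) set \<Rightarrow> 'i set \<Rightarrow> 'i set \<Rightarrow> 'i set \<Rightarrow> ('i \<Rightarrow> (real ^ 2) set) \<Rightarrow> bool" where
  "cell_partition R F E V P \<longleftrightarrow>
     finite F \<and> finite E \<and> finite V \<and>
     F \<inter> E = {} \<and> F \<inter> V = {} \<and> E \<inter> V = {} \<and>
     bounded R \<and> R = (\<Union>f\<in>F. P f) \<and>
     (\<forall>f\<in>F. closed (P f) \<and> convex (P f) \<and> interior (P f) \<noteq> {}) \<and>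
     (\<forall>f\<in>F. \<forall>g\<in>F. f \<noteq> g \<longrightarrow> interior (P f) \<inter> interior (P g) = {}) \<and>
     bij_betw P E {P f \<inter> P g | f g. f \<in> F \<and> g \<in> F \<and> f \<noteq> g \<and> aff_dim (P f \<inter> P g) = 1} \<and>
     bij_betw P V {P d \<inter> P e | d e. d \<in> E \<and> e \<in> E \<and> d \<noteq> e \<and> P d \<inter> P e \<noteq> {}}"

definition convex_planar_body :: "(real ^ 2) set \<Rightarrow> bool" where
  "convex_planar_body x \<longleftrightarrow> compact x \<and> convex x \<and> interior x \<noteq> {}"

definition databases :: "real \<Rightarrow> database set" where
  "databases B = {D. \<forall>x\<in>#D. convex_planar_body x \<and> diameter x \<le> B}"

definition neighbours :: "'r multiset \<Rightarrow> 'r multiset \<Rightarrow> bool" where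
  "neighbours D D' \<longleftrightarrow> size D = size D' \<and> size (D - D') = 1"

text \<open>
  Vectors indexed by a finite set \<open>I\<close> are functions that are \<open>undefined\<close> outside \<open>I\<close>, i.e. elements
  of the space of \<open>\<Pi>\<^sub>M i\<in>I. borel\<close>.
\<close>

definition euler_histogram ::
  "'i set \<Rightarrow> ('i \<Rightarrow> (real ^ 2) set) \<Rightarrow> database \<Rightarrow> 'i \<Rightarrow> real" where
  "euler_histogram I P D = (\<lambda>i\<in>I. real (size {#x \<in># D. x \<inter> P i \<noteq> {}#}))"

text \<open>
  The supremum is a maximum whenever \<open>f\<close> is integer-valued with bounded differences on
  neighbouring pairs (of which there is at least one), as is the case for the Euler histogram.
\<close>

definition L1_sensitivity ::
  "'r multiset set \<Rightarrow> 'i set \<Rightarrow> ('r multiset \<Rightarrow> 'i \<Rightarrow> real) \<Rightarrow> real" where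
  "L1_sensitivity \<D> I f =
     (SUP (D, D') \<in> {(D, D'). D \<in> \<D> \<and> D' \<in> \<D> \<and> neighbours D D'}. \<Sum>i\<in>I. \<bar>f D i - f D' i\<bar>)"

definition laplace_density :: "real \<Rightarrow> real \<Rightarrow> real" where
  "laplace_density l y = 1 / (2 * l) * exp (- \<bar>y\<bar> / l)"

text \<open>
  A randomised mechanism is a family of random variables on a probability space \<open>M\<close>, one for each
  admissible database, with values in the measurable space \<open>N\<close> of responses.
\<close>

definition preserves_differential_privacy ::
  "real \<Rightarrow> 'r multiset set \<Rightarrow> 'w measure \<Rightarrow> 'b measure \<Rightarrow> ('r multiset \<Rightarrow> 'w \<Rightarrow> 'b) \<Rightarrow> bool" where
  "preserves_differential_privacy \<epsilon> \<D> M N A \<longleftrightarrow>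
     prob_space M \<and> (\<forall>D\<in>\<D>. A D \<in> measurable M N) \<and>
     (\<forall>D\<in>\<D>. \<forall>D'\<in>\<D>. neighbours D D' \<longrightarrow>
        (\<forall>C\<in>sets N. \<P>(\<omega> in M. A D \<omega> \<in> C) \<le> exp \<epsilon> * \<P>(\<omega> in M. A D' \<omega> \<in> C)))"

definition diff_priv ::
  "'i set \<Rightarrow> ('i \<Rightarrow> (real ^ 2) set) \<Rightarrow> ('i \<Rightarrow> 'w \<Rightarrow> real) \<Rightarrow> database \<Rightarrow> 'w \<Rightarrow> 'i \<Rightarrow> real" where
  "diff_priv I P Y D \<omega> = (\<lambda>i\<in>I. max 0 (euler_histogram I P D i + Y i \<omega>))"

end

theory Submission
  imports Defs
begin

text \<open>
  Shifting a Laplace density of scale \<open>l\<close> by \<open>d\<close> changes it pointwise by a factor of at most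
  \<open>exp (\<bar>d\<bar> / l)\<close>. By independence the noisy count vectors \<open>H(D) + Y\<close> have product densities, so the
  densities belonging to neighbouring databases differ by a factor of at most
  \<open>exp (\<parallel>H(D) - H(D')\<parallel>\<^sub>1 / l) \<le> exp \<epsilon>\<close>. Truncation at \<open>0\<close> does not depend on the
  database, so the truncated events are preimages of events about \<open>H(D) + Y\<close>.
\<close>

text \<open>Independence makes the joint law the product of the marginal laws. That product has the
  product density, since the two measures agree on boxes by Tonelli and boxes determine a
  sigma-finite product measure.\<close>

lemma (in prob_space) distributed_PiM:
  assumes "finite I" and "product_sigma_finite N"
    and indep: "indep_vars N X I"
    and distr: "\<And>i. i \<in> I \<Longrightarrow> distributed M (N i) (X i) (f i)"
  shows "distributed M (PiM I N) (\<lambda>\<omega>. \<lambda>i\<in>I. X i \<omega>) (\<lambda>x. \<Prod>i\<in>I. f i (x i))"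
proof -
  interpret N: product_sigma_finite N by fact
  have X [measurable]: "X i \<in> measurable M (N i)" if "i \<in> I" for i
    using distr[OF that] by (simp add: distributed_def)
  have f [measurable]: "f i \<in> borel_measurable (N i)" if "i \<in> I" for i
    using distr[OF that] by (simp add: distributed_def)
  have X_PiM: "(\<lambda>\<omega>. \<lambda>i\<in>I. X i \<omega>) \<in> measurable M (PiM I N)"
    by (intro measurable_restrict X)
  have prod_f: "(\<lambda>x. \<Prod>i\<in>I. f i (x i)) \<in> borel_measurable (PiM I N)"
  proof (intro borel_measurable_prod_ennreal)
    show "(\<lambda>x. f i (x i)) \<in> borel_measurable (PiM I N)" if "i \<in> I" for i
      by (rule measurable_compose[OF _ f[OF that]]) (rule measurable_component_singleton[OF that])
  qed
  \<comment> \<open>The locale \<open>product_sigma_finite\<close> asks for sigma-finiteness at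
    every index. Inside \<open>I\<close> it holds because \<open>K i\<close> is the law of
    \<open>X i\<close>, a probability measure; outside, nothing is known about \<open>f i\<close>,
    so \<open>K i\<close> falls back to \<open>N i\<close>.\<close>
  define K where "K i = (if i \<in> I then density (N i) (f i) else N i)" for i
  have K_distr: "K i = distr M (N i) (X i)" if "i \<in> I" for i
    using distributed_distr_eq_density[OF distr[OF that]] that by (simp add: K_def)
  have sets_K: "sets (K i) = sets (N i)" for i
    by (simp add: K_def)
  have "sigma_finite_measure (K i)" for i
  proof (cases "i \<in> I")
    case True
    then interpret D: prob_space "K i"
      by (simp add: K_distr prob_space_distr X)
    show ?thesis by unfold_locales
  next
    case False
    then show ?thesis by (simp add: K_def N.sigma_finite_measures)
  qed
  then interpret K: product_sigma_finite K
    by (simp add: product_sigma_finite_def)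
  have "density (PiM I N) (\<lambda>x. \<Prod>i\<in>I. f i (x i)) = PiM I K"
  proof (rule K.PiM_eqI)
    show "sets (density (PiM I N) (\<lambda>x. \<Prod>i\<in>I. f i (x i))) = sets (PiM I K)"
      by (simp add: sets_K cong: sets_PiM_cong)
    fix A assume "\<And>i. i \<in> I \<Longrightarrow> A i \<in> sets (K i)"
    then have A: "A i \<in> sets (N i)" if "i \<in> I" for i
      using that by (simp add: sets_K)
    have "emeasure (density (PiM I N) (\<lambda>x. \<Prod>i\<in>I. f i (x i))) (Pi\<^sub>E I A)
        = (\<integral>\<^sup>+x. (\<Prod>i\<in>I. f i (x i)) * indicator (Pi\<^sub>E I A) x \<partial>PiM I N)"
      using A \<open>finite I\<close> by (intro emeasure_density prod_f sets_PiM_I_finite)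
    \<comment> \<open>The indicator of a box is a product of coordinate indicators, so the integrand
      splits into functions of one coordinate each.\<close>
    also have "\<dots> = (\<integral>\<^sup>+x. (\<Prod>i\<in>I. f i (x i) * indicator (A i) (x i)) \<partial>PiM I N)"
    proof (rule nn_integral_cong)
      fix x assume "x \<in> space (PiM I N)"
      then have "indicator (Pi\<^sub>E I A) x = (\<Prod>i\<in>I. indicator (A i) (x i) :: ennreal)"
        using \<open>finite I\<close> by (auto simp: indicator_def space_PiM PiE_iff)
      then show "(\<Prod>i\<in>I. f i (x i)) * indicator (Pi\<^sub>E I A) x
          = (\<Prod>i\<in>I. f i (x i) * indicator (A i) (x i))"
        by (simp add: prod.distrib)
    qed
    also have "\<dots> = (\<Prod>i\<in>I. \<integral>\<^sup>+x. f i x * indicator (A i) x \<partial>N i)"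
      using \<open>finite I\<close> A by (intro N.product_nn_integral_prod) auto
    also have "\<dots> = (\<Prod>i\<in>I. emeasure (K i) (A i))"
      using A by (intro prod.cong refl) (simp add: K_def emeasure_density)
    finally show "emeasure (density (PiM I N) (\<lambda>x. \<Prod>i\<in>I. f i (x i))) (Pi\<^sub>E I A)
        = (\<Prod>i\<in>I. emeasure (K i) (A i))" .
  qed fact
  also have "\<dots> = PiM I (\<lambda>i. distr M (N i) (X i))"
    by (intro PiM_cong refl K_distr)
  also have "\<dots> = distr M (PiM I N) (\<lambda>\<omega>. \<lambda>i\<in>I. X i \<omega>)"
  \<comment> \<open>Independence is characterised by product laws for nonempty \<open>I\<close>. For
    empty \<open>I\<close> both sides are the point mass at the function that is
    \<open>undefined\<close> everywhere.\<close>
  proof (cases "I = {}")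
    case True
    show ?thesis
    proof (rule measure_eqI)
      fix A assume "A \<in> sets (PiM I (\<lambda>i. distr M (N i) (X i)))"
      then have "A = {} \<or> A = {\<lambda>_. undefined}"
        using True by (auto simp: PiM_empty)
      then show "emeasure (PiM I (\<lambda>i. distr M (N i) (X i))) A
          = emeasure (distr M (PiM I N) (\<lambda>\<omega>. \<lambda>i\<in>I. X i \<omega>)) A"
        using True X_PiM by (auto simp: PiM_empty emeasure_distr emeasure_space_1 restrict_def)
    qed (use True in \<open>simp add: PiM_empty\<close>)
  next
    case False
    then show ?thesis
      using indep indep_vars_iff_distr_eq_PiM'[of I X N] X by simp
  qed
  finally show ?thesis
    using X_PiM prod_f by (simp add: distributed_def)
qed

lemma laplace_density_nonneg: "l > 0 \<Longrightarrow> laplace_density l y \<ge> 0"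
  by (simp add: laplace_density_def)

text \<open>The exponents compare by the triangle inequality for \<open>y - b\<close>,
  \<open>y - a\<close> and \<open>a - b\<close>; the normalising constants are equal.\<close>

lemma laplace_density_shift_le:
  assumes "l > 0"
  shows "laplace_density l (y - a) \<le> exp (\<bar>a - b\<bar> / l) * laplace_density l (y - b)"
proof -
  have "- \<bar>y - a\<bar> / l \<le> \<bar>a - b\<bar> / l + (- \<bar>y - b\<bar> / l)"
    using assms by (simp add: divide_simps)
  then have "exp (- \<bar>y - a\<bar> / l) \<le> exp (\<bar>a - b\<bar> / l) * exp (- \<bar>y - b\<bar> / l)"
    by (simp flip: exp_add)
  from mult_left_mono[OF this, of "1 / (2 * l)"] assms show ?thesis
    by (simp add: laplace_density_def mult_ac)
qed

lemma (in prob_space) distributed_shifted_laplace_vector: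
  fixes Y :: "'i \<Rightarrow> 'a \<Rightarrow> real"
  assumes "finite I"
    and indep: "indep_vars (\<lambda>_. borel) Y I"
    and distr: "\<And>i. i \<in> I \<Longrightarrow> distributed M lborel (Y i) (\<lambda>y. ennreal (laplace_density l y))"
  shows "distributed M (\<Pi>\<^sub>M i\<in>I. lborel) (\<lambda>\<omega>. \<lambda>i\<in>I. h i + Y i \<omega>)
    (\<lambda>x. \<Prod>i\<in>I. ennreal (laplace_density l (x i - h i)))"
proof (rule distributed_PiM)
  show "product_sigma_finite (\<lambda>_. lborel :: real measure)"
    by unfold_locales
  show "indep_vars (\<lambda>_. lborel) (\<lambda>i \<omega>. h i + Y i \<omega>) I"
    by (rule indep_vars_compose2[OF indep]) simp
  show "distributed M lborel (\<lambda>\<omega>. h i + Y i \<omega>) (\<lambda>y. ennreal (laplace_density l (y - h i)))"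
    if "i \<in> I" for i
    \<comment> \<open>A translation is the affine map of slope 1, so no Jacobian factor
      appears.\<close>
    using distributed_affine[OF distr[OF that], of 1 "h i"] by (simp add: divide_ennreal_def)
qed fact

text \<open>The coordinatewise density ratios multiply, so their exponents add up to the L1 distance
  of \<open>h\<close> and \<open>h'\<close> divided by \<open>l\<close>. Integrating the pointwise
  bound over \<open>C\<close> gives the claim.\<close>

lemma (in prob_space) laplace_mechanism:
  fixes Y :: "'i \<Rightarrow> 'a \<Rightarrow> real"
  assumes "finite I" and "l > 0"
    and indep: "indep_vars (\<lambda>_. borel) Y I"
    and distr: "\<And>i. i \<in> I \<Longrightarrow> distributed M lborel (Y i) (\<lambda>y. ennreal (laplace_density l y))"
    and C: "C \<in> sets (\<Pi>\<^sub>M i\<in>I. borel)"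
  shows "\<P>(\<omega> in M. (\<lambda>i\<in>I. h i + Y i \<omega>) \<in> C)
    \<le> exp ((\<Sum>i\<in>I. \<bar>h i - h' i\<bar>) / l) * \<P>(\<omega> in M. (\<lambda>i\<in>I. h' i + Y i \<omega>) \<in> C)"
proof -
  let ?L = "\<Pi>\<^sub>M i\<in>I. lborel :: real measure"
  let ?g = "\<lambda>h x. \<Prod>i\<in>I. ennreal (laplace_density l (x i - h i))"
  let ?c = "exp ((\<Sum>i\<in>I. \<bar>h i - h' i\<bar>) / l)"
  \<comment> \<open>Densities live over \<open>lborel\<close> while responses are measured by
    \<open>borel\<close>; the two have the same measurable sets.\<close>
  have C': "C \<in> sets ?L"
    using C by (simp cong: sets_PiM_cong)
  note dist = distributed_shifted_laplace_vector[OF \<open>finite I\<close> indep distr]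
  have g: "?g k \<in> borel_measurable ?L" for k
    using dist[of k] by (simp add: distributed_def)
  have prob: "ennreal (\<P>(\<omega> in M. (\<lambda>i\<in>I. k i + Y i \<omega>) \<in> C))
      = (\<integral>\<^sup>+x. ?g k x * indicator C x \<partial>?L)" for k
    using distributed_emeasure[OF dist[of k] C']
    by (simp add: emeasure_eq_measure vimage_def Int_def conj_commute)
  have g_le: "?g h x \<le> ennreal ?c * ?g h' x" for x
  proof -
    have "?g h x \<le> (\<Prod>i\<in>I. ennreal (exp (\<bar>h i - h' i\<bar> / l) * laplace_density l (x i - h' i)))"
      using \<open>l > 0\<close> by (intro prod_mono_ennreal ennreal_leI laplace_density_shift_le)
    also have "\<dots> = ennreal ?c * ?g h' x"
      using \<open>finite I\<close> \<open>l > 0\<close>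
      by (simp add: ennreal_mult laplace_density_nonneg prod.distrib prod_ennreal
          sum_divide_distrib exp_sum)
    finally show ?thesis .
  qed
  have "ennreal (\<P>(\<omega> in M. (\<lambda>i\<in>I. h i + Y i \<omega>) \<in> C))
      \<le> (\<integral>\<^sup>+x. ennreal ?c * (?g h' x * indicator C x) \<partial>?L)"
    unfolding prob using g_le
    by (intro nn_integral_mono) (auto simp: indicator_def)
  also have "\<dots> = ennreal ?c * ennreal (\<P>(\<omega> in M. (\<lambda>i\<in>I. h' i + Y i \<omega>) \<in> C))"
    unfolding prob using g C' by (intro nn_integral_cmult) auto
  also have "\<dots> = ennreal (?c * \<P>(\<omega> in M. (\<lambda>i\<in>I. h' i + Y i \<omega>) \<in> C))"
    by (simp add: ennreal_mult)
  finally show ?thesis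
    by (simp add: ennreal_le_iff)
qed

lemma neighbours_size_filter:
  assumes "neighbours D D'"
  shows "\<bar>real (size (filter_mset Q D)) - real (size (filter_mset Q D'))\<bar> \<le> 1"
proof -
  \<comment> \<open>Multiset difference truncates at zero, so both sides carry the maximum of the
    two multiplicities. Taking sizes shows that \<open>D' - D\<close> is also a single record;
    filtering first then compares the counts.\<close>
  have eq: "D + (D' - D) = D' + (D - D')"
    by (rule multiset_eqI) simp
  have "size (D - D') = 1" and "size D = size D'"
    using assms by (simp_all add: neighbours_def)
  with arg_cong[OF eq, of size] have "size (D' - D) = 1"
    by simp
  then have "size (filter_mset Q (D' - D)) \<le> 1" "size (filter_mset Q (D - D')) \<le> 1"
    using \<open>size (D - D') = 1\<close> size_filter_mset_lesseq by metis+
  moreover have "size (filter_mset Q D) + size (filter_mset Q (D' - D))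
      = size (filter_mset Q D') + size (filter_mset Q (D - D'))"
    using arg_cong[OF eq, of "\<lambda>D. size (filter_mset Q D)"]
    by (simp only: filter_union_mset size_union)
  ultimately show ?thesis
    by linarith
qed

text \<open>
  Boundedness must be checked because the supremum of an unbounded set of reals is a junk value.
\<close>

lemma euler_histogram_L1_sensitivity:
  assumes "D \<in> \<D>" "D' \<in> \<D>" "neighbours D D'"
  shows "(\<Sum>i\<in>I. \<bar>euler_histogram I P D i - euler_histogram I P D' i\<bar>)
    \<le> L1_sensitivity \<D> I (euler_histogram I P)"
proof -
  \<comment> \<open>Replacing one record changes each count by at most 1, so the number of indices
    is a uniform bound.\<close>
  have "(\<Sum>i\<in>I. \<bar>euler_histogram I P A i - euler_histogram I P A' i\<bar>) \<le> (\<Sum>i\<in>I. 1)"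
    if "neighbours A A'" for A A'
    using neighbours_size_filter[OF that]
    by (intro sum_mono) (simp add: euler_histogram_def)
  then have "bdd_above ((\<lambda>(A, A'). \<Sum>i\<in>I. \<bar>euler_histogram I P A i - euler_histogram I P A' i\<bar>) `
      {(A, A'). A \<in> \<D> \<and> A' \<in> \<D> \<and> neighbours A A'})"
    by (intro bdd_aboveI2[where M = "\<Sum>i\<in>I. 1"]) auto
  from cSUP_upper[OF _ this, of "(D, D')"] assms show ?thesis
    by (simp add: L1_sensitivity_def)
qed

theorem corollary3:
  fixes R :: "(real ^ 2) set" and F E V :: "'i set" and P :: "'i \<Rightarrow> (real ^ 2) set"
    and B \<epsilon> \<Delta>H :: real
    and M :: "'w measure" and Y :: "'i \<Rightarrow> 'w \<Rightarrow> real"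
  assumes "cell_partition R F E V P"
    and "B > 0"
    and "\<epsilon> > 0"
    and "\<Delta>H = L1_sensitivity (databases B) (F \<union> E \<union> V) (euler_histogram (F \<union> E \<union> V) P)"
    and "\<Delta>H > 0"
    and "prob_space M"
    and "prob_space.indep_vars M (\<lambda>_. borel) Y (F \<union> E \<union> V)"
    and "\<And>i. i \<in> F \<union> E \<union> V \<Longrightarrow>
           distributed M lborel (Y i) (\<lambda>y. ennreal (laplace_density (\<Delta>H / \<epsilon>) y))"
  shows "preserves_differential_privacy \<epsilon> (databases B) M (\<Pi>\<^sub>M i\<in>F \<union> E \<union> V. borel)
           (diff_priv (F \<union> E \<union> V) P Y)"
proof -
  interpret prob_space M by fact
  let ?I = "F \<union> E \<union> V"
  let ?N = "\<Pi>\<^sub>M i\<in>?I. (borel :: real measure)"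
  let ?H = "euler_histogram ?I P"
  have fin: "finite ?I"
    using assms(1) by (simp add: cell_partition_def)
  have Y: "Y i \<in> borel_measurable M" if "i \<in> ?I" for i
    using assms(8)[OF that] by (simp add: distributed_def)
  have trunc: "(\<lambda>x. \<lambda>i\<in>?I. max 0 (x i)) \<in> measurable ?N ?N"
    by (intro measurable_restrict borel_measurable_max borel_measurable_const
        measurable_component_singleton)
  have "\<P>(\<omega> in M. diff_priv ?I P Y D \<omega> \<in> C) \<le> exp \<epsilon> * \<P>(\<omega> in M. diff_priv ?I P Y D' \<omega> \<in> C)"
    if D: "D \<in> databases B" "D' \<in> databases B" "neighbours D D'" and C: "C \<in> sets ?N" for D D' C
  proof -
    let ?C = "(\<lambda>x. \<lambda>i\<in>?I. max 0 (x i)) -` C \<inter> space ?N"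
    \<comment> \<open>Restricted functions always lie in \<open>space ?N\<close>, so intersecting
      with it in \<open>?C\<close> loses nothing and makes \<open>?C\<close> a measurable
      event.\<close>
    have event: "(diff_priv ?I P Y A \<omega> \<in> C) \<longleftrightarrow> ((\<lambda>i\<in>?I. ?H A i + Y i \<omega>) \<in> ?C)" for A \<omega>
    proof -
      have "(\<lambda>i\<in>?I. max 0 ((\<lambda>i\<in>?I. ?H A i + Y i \<omega>) i)) = diff_priv ?I P Y A \<omega>"
        by (auto simp: diff_priv_def restrict_def)
      then show ?thesis
        by (simp add: space_PiM)
    qed
    have "(\<Sum>i\<in>?I. \<bar>?H D i - ?H D' i\<bar>) \<le> \<Delta>H"
      using euler_histogram_L1_sensitivity[OF D] assms(4) by simp
    \<comment> \<open>This is where the noise scale is calibrated: dividing an L1 distance of at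
      most \<open>\<Delta>H\<close> by \<open>\<Delta>H / \<epsilon>\<close> leaves at most
      \<open>\<epsilon>\<close>.\<close>
    then have "(\<Sum>i\<in>?I. \<bar>?H D i - ?H D' i\<bar>) / (\<Delta>H / \<epsilon>) \<le> \<epsilon>"
      using assms(3,5) by (simp add: divide_simps mult.commute)
    then have "exp ((\<Sum>i\<in>?I. \<bar>?H D i - ?H D' i\<bar>) / (\<Delta>H / \<epsilon>))
          * \<P>(\<omega> in M. (\<lambda>i\<in>?I. ?H D' i + Y i \<omega>) \<in> ?C)
        \<le> exp \<epsilon> * \<P>(\<omega> in M. (\<lambda>i\<in>?I. ?H D' i + Y i \<omega>) \<in> ?C)"
      by (intro mult_right_mono) simp_all
    moreover have "\<P>(\<omega> in M. (\<lambda>i\<in>?I. ?H D i + Y i \<omega>) \<in> ?C)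
        \<le> exp ((\<Sum>i\<in>?I. \<bar>?H D i - ?H D' i\<bar>) / (\<Delta>H / \<epsilon>))
          * \<P>(\<omega> in M. (\<lambda>i\<in>?I. ?H D' i + Y i \<omega>) \<in> ?C)"
      using assms(3,5) measurable_sets[OF trunc C]
      by (intro laplace_mechanism fin assms(7,8)) simp_all
    ultimately show ?thesis
      unfolding event by linarith
  qed
  moreover have "diff_priv ?I P Y D \<in> measurable M ?N" for D
    unfolding diff_priv_def[abs_def]
    by (intro measurable_restrict borel_measurable_max borel_measurable_const
        borel_measurable_add Y)
  ultimately show ?thesis
    using prob_space_axioms by (simp add: preserves_differential_privacy_def)
qed

end
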